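(* Let $D$ be a finite oriented graph (digraph with no loops, no parallel arcs and no pair of anti-parallel arcs) whose underlying undirected graph contains no triangle (i.e. $\omega(D)\le 2$), and such that $D$ contains no induced subdigraph isomorphic to $\vec{P}_6$, the directed path on $6$ vertices. Then $\vec{\chi}(D)\le 382$.
   Context: $\omega(D)$ is the clique number of the underlying undirected graph of $D$. The dichromatic number $\vec{\chi}(D)$ is the minimum integer $k$ such that $V(D)$ can be partitioned into $k$ sets each inducing an acyclic subdigraph (a subdigraph with no directed cycle). $\vec{P}_6$ is the directed path $v_1\to v_2\to\cdots\to v_6$ with arcs $v_iv_{i+1}$ only. *)

theory Defs
  imports
    "Graph_Theory.Digraph_Isomorphism"
    "HOL-Library.Disjoint_Sets"
begin

locale oriented_graph = digraph +
  assumes no_antiparallel: "u \<rightarrow>\<^bsub>G\<^esub> v \<Longrightarrow> \<not> v \<rightarrow>\<^bsub>G\<^esub> u"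

text \<open>The underlying undirected graph is the symmetric digraph \<^const>\<open>mk_symmetric\<close>.\<close>

definition underlying_clique :: "('a,'b) pre_digraph \<Rightarrow> 'a set \<Rightarrow> bool" where
  "underlying_clique D K \<longleftrightarrow>
     K \<subseteq> verts D \<and> (\<forall>u\<in>K. \<forall>v\<in>K. u \<noteq> v \<longrightarrow> u \<rightarrow>\<^bsub>with_proj (mk_symmetric D)\<^esub> v)"

text \<open>Meaningful when \<^term>\<open>verts D\<close> is finite; the empty clique makes the maximum
  well defined for the null graph.\<close>

definition clique_number :: "('a,'b) pre_digraph \<Rightarrow> nat" where
  "clique_number D = Max (card ` {K. underlying_clique D K})"

text \<open>\<^const>\<open>pre_digraph.cycle\<close> is a nonempty directed closed walk without repeated
  vertices; cycles of length 1 and 2 count.\<close>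

definition acyclic_digraph :: "('a,'b) pre_digraph \<Rightarrow> bool" where
  "acyclic_digraph D \<longleftrightarrow> \<not> (\<exists>p. pre_digraph.cycle D p)"

text \<open>Finiteness of \<open>P\<close> is required since \<^const>\<open>card\<close> of an infinite set is \<open>0\<close>.\<close>

definition dicolorable :: "('a,'b) pre_digraph \<Rightarrow> nat \<Rightarrow> bool" where
  "dicolorable D k \<longleftrightarrow>
     (\<exists>P. partition_on (verts D) P \<and> finite P \<and> card P = k \<and>
          (\<forall>X\<in>P. acyclic_digraph (D \<restriction> X)))"

text \<open>Meaningful when \<open>D\<close> is dicolorable with some number of classes, in particular for
  finite loopless digraphs (partition into singletons, see below).\<close>

definition dichromatic_number :: "('a,'b) pre_digraph \<Rightarrow> nat" where
  "dichromatic_number D = (LEAST k. dicolorable D k)"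

definition directed_path :: "nat \<Rightarrow> (nat, nat \<times> nat) pre_digraph" where
  "directed_path n =
     with_proj \<lparr> pverts = {1..n}, parcs = {(i, i + 1) | i. 1 \<le> i \<and> i < n} \<rparr>"

definition contains_induced :: "('a,'b) pre_digraph \<Rightarrow> ('c,'d) pre_digraph \<Rightarrow> bool" where
  "contains_induced D F \<longleftrightarrow> (\<exists>H. induced_subgraph H D \<and> digraph_iso H F)"

lemma (in fin_digraph) finite_underlying_cliques: "finite {K. underlying_clique G K}"
  by (rule finite_subset[of _ "Pow (verts G)"]) (auto simp: underlying_clique_def)

lemma underlying_clique_empty: "underlying_clique D {}"
  by (simp add: underlying_clique_def)

lemma (in digraph) dicolorable_card: "dicolorable G (card (verts G))"
proof -
  let ?P = "(\<lambda>v. {v}) ` verts G"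
  have part: "partition_on (verts G) ?P"
    by (auto simp: partition_on_def disjoint_def)
  have card: "card ?P = card (verts G)"
    by (rule card_image) auto
  have "acyclic_digraph (G \<restriction> {v})" if "v \<in> verts G" for v
  proof -
    have "arcs (G \<restriction> {v}) = {}"
      by (auto simp: induce_subgraph_def dest: no_loops)
    then have "p = []" if "pre_digraph.awalk (G \<restriction> {v}) u p u" for u p
      using that by (metis pre_digraph.awalk_def set_empty subset_empty)
    then show ?thesis
      by (auto simp: acyclic_digraph_def pre_digraph.cycle_def)
  qed
  then show ?thesis
    unfolding dicolorable_def using part card by (intro exI[of _ ?P]) auto
qed

lemma (in digraph) dicolorable_dichromatic_number: "dicolorable G (dichromatic_number G)"
  unfolding dichromatic_number_def using dicolorable_card by (rule LeastI)

end

theory Submission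
  imports Defs
begin

text \<open>
  Call \<open>S \<subseteq> V\<close> dipolar in \<open>V\<close> if no vertex of \<open>S\<close> has both an in-neighbour and an
  out-neighbour in \<open>V - S\<close>. If every nonempty subset of \<open>V\<close> has a nonempty dipolar subset with
  dichromatic number at most \<open>c\<close>, then the dichromatic number of \<open>V\<close> is at most \<open>2 c\<close>; likewise
  a union of dipolar sets of dichromatic number at most \<open>c\<close> has dichromatic number at most \<open>2 c\<close>.

  Breadth-first search, first along the arcs and then against them, reduces the problem to sets
  \<open>W\<close> such that every \<open>w \<in> W\<close> is the middle vertex of a directed walk \<open>z0 \<rightarrow> \<dots> \<rightarrow> z6\<close> in which
  \<open>z0\<close>, \<open>z1\<close> send no arc to \<open>W\<close> and \<open>z5\<close>, \<open>z6\<close> receive none from \<open>W\<close>. Let \<open>Z\<close> be such a walk,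
  \<open>B\<close> the vertices of \<open>W\<close> adjacent to \<open>Z\<close>, and \<open>R = W - B\<close>. Every \<open>b \<in> B\<close> either starts or ends
  an induced path with three vertices of \<open>Z\<close>, or starts one and ends another with two vertices
  of \<open>Z\<close>. As there is no induced directed path on six vertices, in the first case the
  in-neighbours (or out-neighbours) of \<open>b\<close> in \<open>R\<close> form a dipolar subset of \<open>R\<close>, and in the second
  case the neighbours of \<open>b\<close> do together with the second in- and out-neighbours.
  So \<open>B\<close> and these sets together are a dipolar subset of \<open>W\<close> of dichromatic number at most
  \<open>7 + 2 \<cdot> 3 = 13\<close>. This gives 26 colours for \<open>W\<close> and \<open>2 (2 (26 + 1) + 1) = 110\<close> colours in all.
\<close>

section \<open>Colourings with acyclic classes\<close>

definition acyclic_on :: "'a rel \<Rightarrow> 'a set \<Rightarrow> bool" where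
  "acyclic_on r A \<longleftrightarrow> acyclic (Restr r A)"

text \<open>Colour classes may be empty, so the notion is monotone in \<open>k\<close> and passes to
  subsets; a partition into exactly \<open>k\<close> nonempty blocks would not be.\<close>

definition dicol :: "'a rel \<Rightarrow> nat \<Rightarrow> 'a set \<Rightarrow> bool" where
  "dicol r k A \<longleftrightarrow> (\<exists>f. (\<forall>v\<in>A. f v < k) \<and> (\<forall>c. acyclic_on r {v \<in> A. f v = c}))"

definition dipolar :: "'a rel \<Rightarrow> 'a set \<Rightarrow> 'a set \<Rightarrow> bool" where
  "dipolar r S V \<longleftrightarrow>
     S \<subseteq> V \<and> (\<forall>s\<in>S. (\<forall>u\<in>V - S. (s, u) \<notin> r) \<or> (\<forall>u\<in>V - S. (u, s) \<notin> r))"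

lemma acyclic_on_subset: "acyclic_on r B \<Longrightarrow> A \<subseteq> B \<Longrightarrow> acyclic_on r A"
  unfolding acyclic_on_def by (rule acyclic_subset) auto

lemma acyclic_on_converse: "acyclic_on (r\<inverse>) A \<longleftrightarrow> acyclic_on r A"
proof -
  have "Restr (r\<inverse>) A = (Restr r A)\<inverse>"
    by auto
  then show ?thesis
    unfolding acyclic_on_def by (simp only: acyclic_converse)
qed

lemma acyclic_on_stable:
  assumes "\<And>u v. u \<in> A \<Longrightarrow> v \<in> A \<Longrightarrow> (u, v) \<notin> r"
  shows "acyclic_on r A"
proof -
  have "Restr r A = {}"
    using assms by auto
  then show ?thesis
    by (simp add: acyclic_on_def acyclic_def)
qed

text \<open>Along a closed walk \<open>d\<close> never increases, hence is constant, so the walk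
  stays in a single level.\<close>

lemma acyclic_on_levels:
  fixes d :: "'a \<Rightarrow> nat"
  assumes mono: "\<And>u v. u \<in> A \<Longrightarrow> v \<in> A \<Longrightarrow> (u, v) \<in> r \<Longrightarrow> d v \<le> d u"
    and level: "\<And>n. acyclic_on r {v \<in> A. d v = n}"
  shows "acyclic_on r A"
proof -
  \<comment> \<open>The second conjunct is what the induction needs: a walk that ends on its
    starting level has never left that level.\<close>
  have *: "d y \<le> d x \<and> (d x \<le> d y \<longrightarrow> (x, y) \<in> (Restr r {v \<in> A. d v = d x})\<^sup>+)"
    if "(x, y) \<in> (Restr r A)\<^sup>+" for x y
    using that
  proof (induction rule: trancl_induct)
    case (base y)
    then show ?case
      using mono[of x y] by auto
  next
    case (step y z)
    then have yz: "y \<in> A" "z \<in> A" "(y, z) \<in> r" "d z \<le> d y"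
      using mono[of y z] by auto
    show ?case
    proof (intro conjI impI)
      show "d z \<le> d x"
        using step yz by simp
      assume "d x \<le> d z"
      then have "(x, y) \<in> (Restr r {v \<in> A. d v = d x})\<^sup>+" "(y, z) \<in> Restr r {v \<in> A. d v = d x}"
        using step yz by auto
      then show "(x, z) \<in> (Restr r {v \<in> A. d v = d x})\<^sup>+"
        by (rule trancl_into_trancl)
    qed
  qed
  show ?thesis
    unfolding acyclic_on_def acyclic_def
  proof (intro allI notI)
    fix x
    assume "(x, x) \<in> (Restr r A)\<^sup>+"
    then have "(x, x) \<in> (Restr r {v \<in> A. d v = d x})\<^sup>+"
      using * by blast
    with level[of "d x"] show False
      by (simp add: acyclic_on_def acyclic_def)
  qed
qed

lemma dicol_subset: "dicol r k B \<Longrightarrow> A \<subseteq> B \<Longrightarrow> dicol r k A"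
proof -
  assume "dicol r k B" and sub: "A \<subseteq> B"
  then obtain f where f: "\<forall>v\<in>B. f v < k" "\<And>c. acyclic_on r {v \<in> B. f v = c}"
    unfolding dicol_def by blast
  have "acyclic_on r {v \<in> A. f v = c}" for c
    by (rule acyclic_on_subset[OF f(2)[of c]]) (use sub in auto)
  with f(1) sub show ?thesis
    unfolding dicol_def by blast
qed

lemma dicol_mono: "dicol r k A \<Longrightarrow> k \<le> l \<Longrightarrow> dicol r l A"
proof -
  assume "dicol r k A" and "k \<le> l"
  then obtain f where "\<forall>v\<in>A. f v < k" "\<forall>c. acyclic_on r {v \<in> A. f v = c}"
    unfolding dicol_def by blast
  with \<open>k \<le> l\<close> show ?thesis
    unfolding dicol_def by (intro exI[of _ f]) auto
qed

lemma dicol_converse: "dicol (r\<inverse>) k A \<longleftrightarrow> dicol r k A"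
  unfolding dicol_def by (simp add: acyclic_on_converse)

lemma dicol_empty: "dicol r k {}"
  by (simp add: dicol_def acyclic_on_def acyclic_def)

lemma dicol_stable:
  assumes "\<And>u v. u \<in> A \<Longrightarrow> v \<in> A \<Longrightarrow> (u, v) \<notin> r"
  shows "dicol r 1 A"
proof -
  have "acyclic_on r {v \<in> A. 0 = c}" for c :: nat
    using assms by (intro acyclic_on_stable) auto
  then show ?thesis
    unfolding dicol_def by (intro exI[of _ "\<lambda>_. 0"]) simp
qed

lemma dicol_Un:
  assumes "dicol r a A" "dicol r b B"
  shows "dicol r (a + b) (A \<union> B)"
proof -
  from assms obtain g h where
    g: "\<forall>v\<in>A. g v < a" "\<And>c. acyclic_on r {v \<in> A. g v = c}" and
    h: "\<forall>v\<in>B. h v < b" "\<And>c. acyclic_on r {v \<in> B. h v = c}"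
    unfolding dicol_def by blast
  define f where "f v = (if v \<in> A then g v else a + h v)" for v
  have "acyclic_on r {v \<in> A \<union> B. f v = c}" for c
  proof (cases "c < a")
    case True
    then show ?thesis
      by (intro acyclic_on_subset[OF g(2)[of c]]) (auto simp: f_def split: if_splits)
  next
    case False
    then show ?thesis
      using g(1) by (intro acyclic_on_subset[OF h(2)[of "c - a"]]) (auto simp: f_def split: if_splits)
  qed
  moreover have "\<forall>v\<in>A \<union> B. f v < a + b"
    using g(1) h(1) by (auto simp: f_def)
  ultimately show ?thesis
    unfolding dicol_def by blast
qed

lemma dicol_UN:
  assumes "finite I" "\<And>i. i \<in> I \<Longrightarrow> dicol r k (A i)"
  shows "dicol r (card I * k) (\<Union>i\<in>I. A i)"
  using assms
proof (induction I rule: finite_induct)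
  case empty
  then show ?case
    by (simp add: dicol_empty)
next
  case (insert i I)
  then have "dicol r (k + card I * k) (A i \<union> (\<Union>i\<in>I. A i))"
    by (intro dicol_Un) auto
  then show ?case
    using insert.hyps by simp
qed

text \<open>A directed cycle cannot pass from \<open>A\<close> to \<open>B\<close>, so it lies on
  one side and both sides share a palette.\<close>

lemma dicol_split:
  assumes "dicol r k A" "dicol r k B"
    and "\<And>u v. u \<in> A \<Longrightarrow> v \<in> B \<Longrightarrow> (u, v) \<notin> r"
  shows "dicol r k (A \<union> B)"
proof -
  from assms obtain g h where
    g: "\<forall>v\<in>A. g v < k" "\<And>c. acyclic_on r {v \<in> A. g v = c}" and
    h: "\<forall>v\<in>B. h v < k" "\<And>c. acyclic_on r {v \<in> B. h v = c}"
    unfolding dicol_def by blast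
  define f where "f v = (if v \<in> A then g v else h v)" for v
  define d :: "'a \<Rightarrow> nat" where "d v = (if v \<in> A then 0 else 1)" for v
  have "acyclic_on r {v \<in> A \<union> B. f v = c}" for c
  proof (rule acyclic_on_levels[where d = d])
    show "d v \<le> d u" if "u \<in> {v \<in> A \<union> B. f v = c}" "v \<in> {v \<in> A \<union> B. f v = c}" "(u, v) \<in> r" for u v
      using that assms(3) by (auto simp: d_def)
    show "acyclic_on r {v \<in> {v \<in> A \<union> B. f v = c}. d v = n}" for n
    proof (cases "n = 0")
      case True
      then show ?thesis
        by (intro acyclic_on_subset[OF g(2)[of c]]) (auto simp: f_def d_def split: if_splits)
    next
      case False
      then show ?thesis
        by (intro acyclic_on_subset[OF h(2)[of c]]) (auto simp: f_def d_def split: if_splits)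
    qed
  qed
  moreover have "\<forall>v\<in>A \<union> B. f v < k"
    using g(1) h(1) by (auto simp: f_def)
  ultimately show ?thesis
    unfolding dicol_def by blast
qed

section \<open>Colourings built from dipolar sets\<close>

text \<open>A directed cycle alternating between \<open>S\<close> and its complement has to leave and to enter
  \<open>S\<close>; the two kinds of vertices of \<open>S\<close> get disjoint palettes.\<close>

lemma dicol_dipolar:
  assumes dip: "dipolar r S V" and S: "dicol r c S" and rest: "dicol r (2 * c) (V - S)"
  shows "dicol r (2 * c) V"
proof -
  \<comment> \<open>Vertices of \<open>P\<close> use the colours below \<open>c\<close>; the rest of
    \<open>S\<close>, which receive no arc from \<open>V - S\<close> by dipolarity, use those from
    \<open>c\<close> on.\<close>
  define P where "P = {s \<in> S. \<forall>u\<in>V - S. (s, u) \<notin> r}"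
  from S rest obtain g h where
    g: "\<forall>v\<in>S. g v < c" "\<And>k. acyclic_on r {v \<in> S. g v = k}" and
    h: "\<forall>v\<in>V - S. h v < 2 * c" "\<And>k. acyclic_on r {v \<in> V - S. h v = k}"
    unfolding dicol_def by blast
  define f where "f v = (if v \<in> S then if v \<in> P then g v else c + g v else h v)" for v
  have "acyclic_on r {v \<in> V. f v = k}" for k
  proof (cases "k < c")
    case True
    \<comment> \<open>For colours below \<open>c\<close> no arc leaves \<open>S\<close>, so
      \<open>S\<close> is the lower level; for the other colours none enters it and the levels are
      swapped.\<close>
    define d :: "'a \<Rightarrow> nat" where "d v = (if v \<in> S then 0 else 1)" for v
    show ?thesis
    proof (rule acyclic_on_levels[where d = d])
      show "d v \<le> d u" if "u \<in> {v \<in> V. f v = k}" "v \<in> {v \<in> V. f v = k}" "(u, v) \<in> r" for u v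
        using that True by (auto simp: d_def f_def P_def split: if_splits)
      show "acyclic_on r {v \<in> {v \<in> V. f v = k}. d v = n}" for n
      proof (cases "n = 0")
        case n: True
        then show ?thesis
          using True
          by (intro acyclic_on_subset[OF g(2)[of k]]) (auto simp: f_def d_def split: if_splits)
      next
        case False
        then show ?thesis
          by (intro acyclic_on_subset[OF h(2)[of k]]) (auto simp: f_def d_def split: if_splits)
      qed
    qed
  next
    case False
    define d :: "'a \<Rightarrow> nat" where "d v = (if v \<in> S then 1 else 0)" for v
    show ?thesis
    proof (rule acyclic_on_levels[where d = d])
      show "d v \<le> d u" if "u \<in> {v \<in> V. f v = k}" "v \<in> {v \<in> V. f v = k}" "(u, v) \<in> r" for u v
      proof (cases "v \<in> S \<and> u \<notin> S")
        case True
        then have "v \<in> S - P"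
          using that False g(1) by (auto simp: f_def split: if_splits)
        then have "(u, v) \<notin> r"
          using dip that True unfolding dipolar_def P_def by blast
        with that show ?thesis
          by simp
      qed (auto simp: d_def)
      show "acyclic_on r {v \<in> {v \<in> V. f v = k}. d v = n}" for n
      proof (cases "n = 0")
        case True
        then show ?thesis
          by (intro acyclic_on_subset[OF h(2)[of k]]) (auto simp: f_def d_def split: if_splits)
      next
        case n: False
        then show ?thesis
          using False g(1)
          by (intro acyclic_on_subset[OF g(2)[of "k - c"]]) (auto simp: f_def d_def split: if_splits)
      qed
    qed
  qed
  moreover have "\<forall>v\<in>V. f v < 2 * c"
    using g(1) h(1) by (force simp: f_def)
  ultimately show ?thesis
    unfolding dicol_def by blast
qed

lemma dipolar_mono: "dipolar r S V \<Longrightarrow> S \<subseteq> U \<Longrightarrow> U \<subseteq> V \<Longrightarrow> dipolar r S U"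
  unfolding dipolar_def by blast

text \<open>Each \<open>S i\<close> remains dipolar in the union, so it can be peeled off while the
  other sets reuse the same \<open>2 * c\<close> colours; the bound does not grow with
  \<open>I\<close>.\<close>

lemma dicol_UN_dipolar:
  assumes "finite I"
    and "\<And>i. i \<in> I \<Longrightarrow> dipolar r (S i) V" "\<And>i. i \<in> I \<Longrightarrow> dicol r c (S i)"
  shows "dicol r (2 * c) (\<Union>i\<in>I. S i)"
  using assms
proof (induction I rule: finite_induct)
  case empty
  then show ?case
    by (simp add: dicol_empty)
next
  case (insert i I)
  have "dipolar r (S i) (\<Union>j\<in>insert i I. S j)"
  proof (rule dipolar_mono)
    show "dipolar r (S i) V"
      using insert.prems by simp
    show "(\<Union>j\<in>insert i I. S j) \<subseteq> V"
      using insert.prems(1) unfolding dipolar_def by blast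
  qed auto
  moreover have "dicol r (2 * c) ((\<Union>j\<in>insert i I. S j) - S i)"
    by (rule dicol_subset[of _ _ "\<Union>j\<in>I. S j"]) (use insert in auto)
  moreover have "dicol r c (S i)"
    using insert.prems(2) by simp
  ultimately show ?case
    by (metis dicol_dipolar)
qed

text \<open>Peel off a dipolar set and colour the remainder by induction with the same
  \<open>2 * c\<close> colours.\<close>

lemma dicol_if_dipolar_subsets:
  assumes "finite V"
    and "\<And>W. W \<subseteq> V \<Longrightarrow> W \<noteq> {} \<Longrightarrow> \<exists>S. S \<noteq> {} \<and> dipolar r S W \<and> dicol r c S"
  shows "dicol r (2 * c) V"
  using assms
proof (induction V rule: finite_psubset_induct)
  case (psubset V)
  show ?case
  proof (cases "V = {}")
    case True
    then show ?thesis
      by (simp add: dicol_empty)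
  next
    case False
    then obtain S where S: "S \<noteq> {}" "dipolar r S V" "dicol r c S"
      using psubset.prems by blast
    then have "V - S \<subset> V"
      unfolding dipolar_def by blast
    then have "dicol r (2 * c) (V - S)"
      using psubset.prems by (intro psubset.IH) auto
    with S(2,3) show ?thesis
      by (rule dicol_dipolar)
  qed
qed

section \<open>Layers of a breadth-first search\<close>

text \<open>An arc can climb at most one layer, so a directed cycle inside the union of the layers of
  one parity stays in a single layer.\<close>

lemma dicol_layers:
  fixes d :: "'a \<Rightarrow> nat"
  assumes arc: "\<And>u v. u \<in> Q \<Longrightarrow> v \<in> Q \<Longrightarrow> (u, v) \<in> r \<Longrightarrow> d v \<le> Suc (d u)"
    and layer: "\<And>n. dicol r k {v \<in> Q. d v = n}"
  shows "dicol r (2 * k) Q"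
proof -
  have "\<exists>g. (\<forall>v\<in>{v \<in> Q. d v = n}. g v < k) \<and>
      (\<forall>c. acyclic_on r {v \<in> {v \<in> Q. d v = n}. g v = c})" for n
    using layer unfolding dicol_def by blast
  then have "\<exists>g. \<forall>n. (\<forall>v\<in>{v \<in> Q. d v = n}. g n v < k) \<and>
      (\<forall>c. acyclic_on r {v \<in> {v \<in> Q. d v = n}. g n v = c})"
    by (intro choice allI)
  then obtain g where *: "\<forall>n. (\<forall>v\<in>{v \<in> Q. d v = n}. g n v < k) \<and>
      (\<forall>c. acyclic_on r {v \<in> {v \<in> Q. d v = n}. g n v = c})"
    by (rule exE)
  have g: "g n v < k" if "v \<in> Q" "d v = n" for n v
    using * that by simp
  have g': "acyclic_on r {v \<in> {v \<in> Q. d v = n}. g n v = c}" for n c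
    using * by blast
  \<comment> \<open>Even and odd layers get disjoint palettes, so equal colours imply equal parity
    and exclude a climb by exactly one layer.\<close>
  define f where "f v = (if even (d v) then g (d v) v else k + g (d v) v)" for v
  have "acyclic_on r {v \<in> Q. f v = c}" for c
  proof (rule acyclic_on_levels[where d = d])
    show "d v \<le> d u" if "u \<in> {v \<in> Q. f v = c}" "v \<in> {v \<in> Q. f v = c}" "(u, v) \<in> r" for u v
    proof -
      have "f u = c" "f v = c" "g (d u) u < k" "g (d v) v < k"
        using that g by auto
      then have "even (d u) = even (d v)"
        unfolding f_def by (auto split: if_splits)
      then have "d v \<noteq> Suc (d u)"
        by auto
      then show ?thesis
        using arc[of u v] that by auto
    qed
    show "acyclic_on r {v \<in> {v \<in> Q. f v = c}. d v = n}" for n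
      by (rule acyclic_on_subset[OF g'[of n "if even n then c else c - k"]])
        (auto simp: f_def)
  qed
  moreover have "\<forall>v\<in>Q. f v < 2 * k"
    using g by (force simp: f_def)
  ultimately show ?thesis
    unfolding dicol_def by blast
qed

section \<open>Neighbourhoods and head sets\<close>

definition nb :: "'a rel \<Rightarrow> 'a \<Rightarrow> 'a set" where
  "nb r v = r `` {v} \<union> r\<inverse> `` {v}"

lemma nb_sym: "u \<in> nb r v \<longleftrightarrow> v \<in> nb r u"
  by (auto simp: nb_def)

lemma nb_converse: "nb (r\<inverse>) v = nb r v"
  by (auto simp: nb_def)

lemma nbI: "(u, v) \<in> r \<Longrightarrow> u \<in> nb r v" "(u, v) \<in> r \<Longrightarrow> v \<in> nb r u"
  by (auto simp: nb_def)

text \<open>This is one half of the seven-vertex walk through \<open>w\<close>; the other half is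
  the same condition for the converse relation.\<close>

definition head_set :: "'a rel \<Rightarrow> 'a set \<Rightarrow> bool" where
  "head_set r W \<longleftrightarrow> (\<forall>w\<in>W. \<exists>x y z. (x, y) \<in> r \<and> (y, z) \<in> r \<and> (z, w) \<in> r \<and>
     (\<forall>b\<in>W. (x, b) \<notin> r \<and> (y, b) \<notin> r))"

lemma head_set_subset: "head_set r W \<Longrightarrow> U \<subseteq> W \<Longrightarrow> head_set r U"
proof -
  assume W: "head_set r W" and sub: "U \<subseteq> W"
  show "head_set r U"
    unfolding head_set_def
  proof
    fix w
    assume "w \<in> U"
    with W sub obtain x y z where "(x, y) \<in> r" "(y, z) \<in> r" "(z, w) \<in> r"
      "\<forall>b\<in>W. (x, b) \<notin> r \<and> (y, b) \<notin> r"
      unfolding head_set_def by (meson subsetD)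
    with sub show "\<exists>x y z. (x, y) \<in> r \<and> (y, z) \<in> r \<and> (z, w) \<in> r \<and>
        (\<forall>b\<in>U. (x, b) \<notin> r \<and> (y, b) \<notin> r)"
      by (intro exI[of _ x] exI[of _ y] exI[of _ z]) auto
  qed
qed

text \<open>The hypotheses are stated for the arc relation, where reversing all arcs is just
  \<open>converse\<close>. In \<open>P6\<close>, distinctness of the six vertices follows from the
  arcs and non-adjacencies.\<close>

locale trifree_P6 =
  fixes r :: "'a rel"
  assumes antiparallel: "(u, v) \<in> r \<Longrightarrow> (v, u) \<notin> r"
    and triangle: "(u, v) \<in> r \<Longrightarrow> u \<in> nb r w \<Longrightarrow> v \<notin> nb r w"
    and P6: "(a, b) \<in> r \<Longrightarrow> (b, c) \<in> r \<Longrightarrow> (c, d) \<in> r \<Longrightarrow> (d, e) \<in> r \<Longrightarrow> (e, f) \<in> r \<Longrightarrow>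
      c \<notin> nb r a \<Longrightarrow> d \<notin> nb r a \<Longrightarrow> e \<notin> nb r a \<Longrightarrow> f \<notin> nb r a \<Longrightarrow>
      d \<notin> nb r b \<Longrightarrow> e \<notin> nb r b \<Longrightarrow> f \<notin> nb r b \<Longrightarrow>
      e \<notin> nb r c \<Longrightarrow> f \<notin> nb r c \<Longrightarrow> f \<notin> nb r d \<Longrightarrow> False"
begin

lemma converse_trifree_P6: "trifree_P6 (r\<inverse>)"
proof
  show "(v, u) \<notin> r\<inverse>" if "(u, v) \<in> r\<inverse>" for u v
    using that antiparallel by blast
  show "v \<notin> nb (r\<inverse>) w" if "(u, v) \<in> r\<inverse>" "u \<in> nb (r\<inverse>) w" for u v w
    using that triangle[of v u w] by (auto simp: nb_converse)
next
  fix a b c d e f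
  assume "(a, b) \<in> r\<inverse>" "(b, c) \<in> r\<inverse>" "(c, d) \<in> r\<inverse>" "(d, e) \<in> r\<inverse>" "(e, f) \<in> r\<inverse>"
    "c \<notin> nb (r\<inverse>) a" "d \<notin> nb (r\<inverse>) a" "e \<notin> nb (r\<inverse>) a" "f \<notin> nb (r\<inverse>) a"
    "d \<notin> nb (r\<inverse>) b" "e \<notin> nb (r\<inverse>) b" "f \<notin> nb (r\<inverse>) b"
    "e \<notin> nb (r\<inverse>) c" "f \<notin> nb (r\<inverse>) c" "f \<notin> nb (r\<inverse>) d"
  then show False
    by (intro P6[of f e d c b a]) (auto simp: nb_def)
qed

lemma nb_path2: "(u, v) \<in> r \<Longrightarrow> (v, w) \<in> r \<Longrightarrow> w \<notin> nb r u"
  using triangle[of u v w] nbI(1)[of v w r] nb_sym[of w r u] by blast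

text \<open>Two adjacent neighbours of \<open>v\<close> would form a triangle with it, so
  neighbourhoods are stable.\<close>

lemma dicol_nb: "dicol r 1 (A \<inter> nb r v)"
proof (rule dicol_stable)
  show "(x, y) \<notin> r" if "x \<in> A \<inter> nb r v" "y \<in> A \<inter> nb r v" for x y
    using triangle[of x y v] that by auto
qed

text \<open>Layer by distance from \<open>v0\<close> inside \<open>V\<close>. From distance three
  on, a shortest path supplies the walk of \<open>head_set\<close>; the vertex \<open>p\<close>
  before \<open>v0\<close> supplies the missing one at distance two.\<close>

lemma dicol_reachable:
  assumes "p \<in> V" "(p, v0) \<in> r" "v0 \<in> V"
    and heads: "\<And>W. W \<subseteq> V \<Longrightarrow> head_set r W \<Longrightarrow> dicol r k W"
  shows "dicol r (2 * (k + 1)) {v. (v0, v) \<in> (Restr r V)\<^sup>*}"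
proof -
  define Q where "Q = {v. (v0, v) \<in> (Restr r V)\<^sup>*}"
  define d where "d v = (LEAST n. (v0, v) \<in> Restr r V ^^ n)" for v
  have d_path: "(v0, v) \<in> Restr r V ^^ d v" if "v \<in> Q" for v
  proof -
    have "\<exists>n. (v0, v) \<in> Restr r V ^^ n"
      using that rtrancl_imp_relpow unfolding Q_def by blast
    then show ?thesis
      unfolding d_def by (rule LeastI_ex)
  qed
  have d_le: "d v \<le> n" if "(v0, v) \<in> Restr r V ^^ n" for v n
    using that unfolding d_def by (rule Least_le)
  have QV: "Q \<subseteq> V"
    using assms(3) unfolding Q_def by (auto elim: rtranclE)
  have arc: "d v \<le> Suc (d u)" if "u \<in> Q" "v \<in> Q" "(u, v) \<in> r" for u v
  proof (rule d_le)
    have "(u, v) \<in> Restr r V"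
      using that QV by auto
    with d_path[OF that(1)] show "(v0, v) \<in> Restr r V ^^ Suc (d u)"
      by auto
  qed
  have pred: "\<exists>u\<in>Q. (u, v) \<in> r \<and> d u = n" if "v \<in> Q" "d v = Suc n" for v n
  proof -
    from d_path[OF that(1)] that(2) obtain u where
      u: "(v0, u) \<in> Restr r V ^^ n" "(u, v) \<in> Restr r V"
      by auto
    then have "u \<in> Q"
      unfolding Q_def using relpow_imp_rtrancl by blast
    moreover have "d u \<le> n"
      using u(1) by (rule d_le)
    moreover have "d v \<le> Suc (d u)"
      using arc[OF \<open>u \<in> Q\<close> that(1)] u by auto
    ultimately show ?thesis
      using u that by (intro bexI[of _ u]) auto
  qed
  have d0: "v = v0" if "v \<in> Q" "d v = 0" for v
    using d_path[OF that(1)] that(2) by simp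
  have "v0 \<in> Q"
    by (simp add: Q_def)
  have "d v0 = 0"
    using d_le[of v0 0] by simp
  have "dicol r (k + 1) {v \<in> Q. d v = n}" for n
  proof -
    consider "n = 0" | "n = 1" | "n = 2" | "n \<ge> 3"
      by linarith
    then show ?thesis
    proof cases
      case 1
      then have "dicol r 1 {v \<in> Q. d v = n}"
        using d0 antiparallel by (intro dicol_stable) blast
      then show ?thesis
        by (rule dicol_mono) simp
    next
      case 2
      have "v \<in> nb r v0" if v: "v \<in> Q" "d v = n" for v
      proof -
        obtain u where "u \<in> Q" "(u, v) \<in> r" "d u = 0"
          using pred[of v 0] v 2 by auto
        with d0[of u] show ?thesis
          by (auto intro: nbI)
      qed
      then have "{v \<in> Q. d v = n} \<subseteq> UNIV \<inter> nb r v0"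
        by auto
      then have "dicol r 1 {v \<in> Q. d v = n}"
        by (rule dicol_subset[OF dicol_nb])
      then show ?thesis
        by (rule dicol_mono) simp
    next
      case 3
      let ?L = "{v \<in> Q. d v = n}"
      \<comment> \<open>The walk is \<open>p\<close>, \<open>v0\<close>, \<open>u\<close>,
        \<open>w\<close>. Since \<open>p\<close> may send arcs into this layer, its neighbours are
        split off; being stable, they cost the one extra colour.\<close>
      have "head_set r (?L - nb r p)"
        unfolding head_set_def
      proof
        fix w
        assume w: "w \<in> ?L - nb r p"
        then obtain u where u: "u \<in> Q" "(u, w) \<in> r" "d u = 1"
          using pred[of w 1] 3 by auto
        moreover have "(v0, u) \<in> r"
        proof -
          obtain u' where "u' \<in> Q" "(u', u) \<in> r" "d u' = 0"
            using pred[of u 0] u by auto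
          with d0[of u'] show ?thesis
            by simp
        qed
        moreover have "(p, b) \<notin> r \<and> (v0, b) \<notin> r" if "b \<in> ?L - nb r p" for b
          using that arc[of v0 b] \<open>v0 \<in> Q\<close> \<open>d v0 = 0\<close> 3 by (auto intro: nbI)
        ultimately show "\<exists>x y z. (x, y) \<in> r \<and> (y, z) \<in> r \<and> (z, w) \<in> r \<and>
            (\<forall>b\<in>?L - nb r p. (x, b) \<notin> r \<and> (y, b) \<notin> r)"
          using assms(2) by blast
      qed
      then have "dicol r k (?L - nb r p)"
        using QV by (intro heads) auto
      from dicol_Un[OF this dicol_nb[of ?L p]] show ?thesis
        by (simp add: Un_commute Un_Diff_Int)
    next
      case 4
      define m where "m = n - 3"
      with 4 have n: "n = Suc (Suc (Suc m))"
        by simp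
      let ?L = "{v \<in> Q. d v = n}"
      \<comment> \<open>The vertices \<open>x\<close> and \<open>y\<close> lie three and two layers
        below \<open>w\<close>, too far down for an arc into this layer.\<close>
      have "head_set r ?L"
        unfolding head_set_def
      proof
        fix w
        assume "w \<in> ?L"
        then obtain z where z: "z \<in> Q" "(z, w) \<in> r" "d z = Suc (Suc m)"
          using pred[of w "Suc (Suc m)"] n by auto
        then obtain y where y: "y \<in> Q" "(y, z) \<in> r" "d y = Suc m"
          using pred[of z "Suc m"] by auto
        then obtain x where x: "x \<in> Q" "(x, y) \<in> r" "d x = m"
          using pred[of y m] by auto
        have "(x, b) \<notin> r \<and> (y, b) \<notin> r" if "b \<in> ?L" for b
          using arc[of x b] arc[of y b] that x y n by auto
        with x y z show "\<exists>x y z. (x, y) \<in> r \<and> (y, z) \<in> r \<and> (z, w) \<in> r \<and>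
            (\<forall>b\<in>?L. (x, b) \<notin> r \<and> (y, b) \<notin> r)"
          by blast
      qed
      then have "dicol r k ?L"
        using QV by (intro heads) auto
      then show ?thesis
        by (rule dicol_mono) simp
    qed
  qed
  with arc show ?thesis
    unfolding Q_def[symmetric] by (rule dicol_layers)
qed

text \<open>A vertex without in-neighbour in \<open>V\<close> lies on no cycle and is removed. If
  there is none, some \<open>v0\<close> has an in-neighbour \<open>p\<close> as
  \<open>dicol_reachable\<close> requires, and no arc leaves the set reachable from
  \<open>v0\<close>, so \<open>dicol_split\<close> reuses the palette on the rest.\<close>

lemma dicol_if_head_sets:
  assumes "finite V" "\<And>W. W \<subseteq> V \<Longrightarrow> head_set r W \<Longrightarrow> dicol r k W"
  shows "dicol r (2 * (k + 1)) V"
  using assms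
proof (induction V rule: finite_psubset_induct)
  case (psubset V)
  have IH: "dicol r (2 * (k + 1)) U" if "U \<subset> V" for U
  proof (rule psubset.IH[OF that])
    fix W
    assume "W \<subseteq> U" "head_set r W"
    then show "dicol r k W"
      using that by (intro psubset.prems) auto
  qed
  show ?case
  proof (cases "\<forall>v\<in>V. \<exists>p\<in>V. (p, v) \<in> r")
    case False
    then obtain v where v: "v \<in> V" "\<forall>p\<in>V. (p, v) \<notin> r"
      by blast
    have "dicol r (2 * (k + 1)) ((V - {v}) \<union> {v})"
    proof (rule dicol_split)
      show "dicol r (2 * (k + 1)) (V - {v})"
        using v by (intro IH) auto
      have "dicol r 1 {v}"
        using v by (intro dicol_stable) auto
      then show "dicol r (2 * (k + 1)) {v}"
        by (rule dicol_mono) simp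
    qed (use v in auto)
    moreover have "(V - {v}) \<union> {v} = V"
      using v by auto
    ultimately show ?thesis
      by simp
  next
    case True
    show ?thesis
    proof (cases "V = {}")
      case True
      then show ?thesis
        by (simp add: dicol_empty)
    next
      case False
      then obtain v0 p where v0: "v0 \<in> V" "p \<in> V" "(p, v0) \<in> r"
        using True by blast
      define Q where "Q = {v. (v0, v) \<in> (Restr r V)\<^sup>*}"
      have Q: "Q \<subseteq> V" "v0 \<in> Q"
        using v0 unfolding Q_def by (auto elim: rtranclE)
      have "dicol r (2 * (k + 1)) (Q \<union> (V - Q))"
      proof (rule dicol_split)
        show "dicol r (2 * (k + 1)) Q"
          unfolding Q_def using v0(2,3,1) psubset.prems by (rule dicol_reachable)
        show "dicol r (2 * (k + 1)) (V - Q)"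
          using Q v0 by (intro IH) auto
        show "(u, v) \<notin> r" if "u \<in> Q" "v \<in> V - Q" for u v
        proof
          assume "(u, v) \<in> r"
          then have "(u, v) \<in> Restr r V"
            using that Q by auto
          with that(1) have "v \<in> Q"
            unfolding Q_def by (auto intro: rtrancl_into_rtrancl)
          with that show False
            by simp
        qed
      qed
      moreover have "Q \<union> (V - Q) = V"
        using Q by auto
      ultimately show ?thesis
        by simp
    qed
  qed
qed

end

section \<open>Dipolar sets around a directed walk\<close>

text \<open>In a triangle-free digraph the paths below are induced: a path on four vertices can only
  have the chord between its ends.\<close>

definition starts2 :: "'a rel \<Rightarrow> 'a set \<Rightarrow> 'a \<Rightarrow> bool" where
  "starts2 r Z b \<longleftrightarrow> (\<exists>x\<in>Z. \<exists>y\<in>Z. (b, x) \<in> r \<and> (x, y) \<in> r)"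

definition starts3 :: "'a rel \<Rightarrow> 'a set \<Rightarrow> 'a \<Rightarrow> bool" where
  "starts3 r Z b \<longleftrightarrow> (\<exists>x\<in>Z. \<exists>y\<in>Z. \<exists>z\<in>Z. (b, x) \<in> r \<and> (x, y) \<in> r \<and> (y, z) \<in> r \<and> z \<notin> nb r b)"

lemma starts2I: "(b, x) \<in> r \<Longrightarrow> (x, y) \<in> r \<Longrightarrow> x \<in> Z \<Longrightarrow> y \<in> Z \<Longrightarrow> starts2 r Z b"
  unfolding starts2_def by blast

lemma starts3I:
  "(b, x) \<in> r \<Longrightarrow> (x, y) \<in> r \<Longrightarrow> (y, z) \<in> r \<Longrightarrow> z \<notin> nb r b \<Longrightarrow> x \<in> Z \<Longrightarrow> y \<in> Z \<Longrightarrow> z \<in> Z \<Longrightarrow>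
    starts3 r Z b"
  unfolding starts3_def by blast

text \<open>An in-neighbour \<open>a\<close> of \<open>b\<close> in \<open>R\<close> has no
  in-neighbour \<open>a'\<close> in \<open>R\<close>: otherwise \<open>a'\<close>, \<open>a\<close>,
  \<open>b\<close>, \<open>x\<close>, \<open>y\<close>, \<open>z\<close> would be an induced
  directed path.\<close>

lemma (in trifree_P6) dipolar_in_neighbours:
  assumes far: "\<And>a z. a \<in> R \<Longrightarrow> z \<in> Z \<Longrightarrow> z \<notin> nb r a" and b: "starts3 r Z b"
  shows "dipolar r (r\<inverse> `` {b} \<inter> R) R"
proof -
  from b obtain x y z where Z: "x \<in> Z" "y \<in> Z" "z \<in> Z"
    and path: "(b, x) \<in> r" "(x, y) \<in> r" "(y, z) \<in> r" "z \<notin> nb r b"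
    unfolding starts3_def by blast
  have "(a', a) \<notin> r" if "a \<in> R" "a' \<in> R" "(a, b) \<in> r" for a a'
  proof
    assume "(a', a) \<in> r"
    with that path Z show False
      using P6[of a' a b x y z] far nb_path2 by blast
  qed
  then show ?thesis
    unfolding dipolar_def by blast
qed

text \<open>In-neighbours of \<open>b\<close> have all their in-neighbours in \<open>A\<close>, and
  those of \<open>A\<close> are adjacent to \<open>b\<close>, as otherwise \<open>b\<close> and its
  two-vertex continuation in \<open>Z\<close> would complete an induced six-vertex path.
  \<open>C\<close> is dual. Hence the set is closed on one side at each of its vertices, and it is a
  union of three stable sets.\<close>

lemma (in trifree_P6) dipolar_two_steps:
  assumes far: "\<And>a z. a \<in> R \<Longrightarrow> z \<in> Z \<Longrightarrow> z \<notin> nb r a"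
    and b: "starts2 r Z b" "starts2 (r\<inverse>) Z b"
  defines "A \<equiv> {a \<in> R. \<exists>a'\<in>R. (a, a') \<in> r \<and> (a', b) \<in> r}"
    and "C \<equiv> {a \<in> R. \<exists>a'\<in>R. (a', a) \<in> r \<and> (b, a') \<in> r}"
  shows "dipolar r (R \<inter> nb r b \<union> (A - nb r b) \<union> (C - nb r b)) R"
    and "dicol r 3 (R \<inter> nb r b \<union> (A - nb r b) \<union> (C - nb r b))"
proof -
  have A: "a'' \<in> nb r b" if "a \<in> A" "a'' \<in> R" "(a'', a) \<in> r" for a a''
  proof (rule ccontr)
    assume n: "a'' \<notin> nb r b"
    from that obtain a' where a': "a \<in> R" "a' \<in> R" "(a, a') \<in> r" "(a', b) \<in> r"
      unfolding A_def by blast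
    from b(1) obtain x y where "x \<in> Z" "y \<in> Z" "(b, x) \<in> r" "(x, y) \<in> r"
      unfolding starts2_def by blast
    with a' that n show False
      using P6[of a'' a a' b x y] far nb_path2 nb_sym[of a'' r b] by blast
  qed
  have C: "a'' \<in> nb r b" if "a \<in> C" "a'' \<in> R" "(a, a'') \<in> r" for a a''
  proof (rule ccontr)
    assume n: "a'' \<notin> nb r b"
    from that obtain a' where a': "a \<in> R" "a' \<in> R" "(a', a) \<in> r" "(b, a') \<in> r"
      unfolding C_def by blast
    from b(2) obtain x y where xy: "x \<in> Z" "y \<in> Z" "(x, b) \<in> r" "(y, x) \<in> r"
      unfolding starts2_def by blast
    have "u \<notin> nb r z" if "u \<in> R" "z \<in> Z" for u z
      using far[OF that] nb_sym[of u r z] by simp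
    with a' that n xy show False
      using P6[of y x b a' a a''] nb_path2 by blast
  qed
  show "dipolar r (R \<inter> nb r b \<union> (A - nb r b) \<union> (C - nb r b)) R"
    unfolding dipolar_def
  proof (intro conjI ballI)
    show "R \<inter> nb r b \<union> (A - nb r b) \<union> (C - nb r b) \<subseteq> R"
      unfolding A_def C_def by blast
    fix s
    assume "s \<in> R \<inter> nb r b \<union> (A - nb r b) \<union> (C - nb r b)"
    then consider "s \<in> R" "(s, b) \<in> r" | "s \<in> R" "(b, s) \<in> r" | "s \<in> A" | "s \<in> C"
      unfolding nb_def by blast
    then show "(\<forall>u\<in>R - (R \<inter> nb r b \<union> (A - nb r b) \<union> (C - nb r b)). (s, u) \<notin> r) \<or>
        (\<forall>u\<in>R - (R \<inter> nb r b \<union> (A - nb r b) \<union> (C - nb r b)). (u, s) \<notin> r)"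
    proof cases
      case 1
      then have "u \<in> A" if "u \<in> R" "(u, s) \<in> r" for u
        using that unfolding A_def by blast
      then show ?thesis
        by blast
    next
      case 2
      then have "u \<in> C" if "u \<in> R" "(s, u) \<in> r" for u
        using that unfolding C_def by blast
      then show ?thesis
        by blast
    next
      case 3
      then show ?thesis
        using A by blast
    next
      case 4
      then show ?thesis
        using C by blast
    qed
  qed
  have "dicol r 1 (A - nb r b)"
  proof (rule dicol_stable)
    show "(u, v) \<notin> r" if "u \<in> A - nb r b" "v \<in> A - nb r b" for u v
      using that A[of v u] unfolding A_def by blast
  qed
  moreover have "dicol r 1 (C - nb r b)"
  proof (rule dicol_stable)
    show "(u, v) \<notin> r" if "u \<in> C - nb r b" "v \<in> C - nb r b" for u v
      using that C[of u v] unfolding C_def by blast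
  qed
  ultimately have "dicol r (1 + 1 + 1) (R \<inter> nb r b \<union> (A - nb r b) \<union> (C - nb r b))"
    using dicol_nb by (intro dicol_Un)
  then show "dicol r 3 (R \<inter> nb r b \<union> (A - nb r b) \<union> (C - nb r b))"
    by (simp add: numeral_3_eq_3)
qed

lemma dipolar_converse: "dipolar (r\<inverse>) S V \<longleftrightarrow> dipolar r S V"
  unfolding dipolar_def by auto

context trifree_P6
begin

text \<open>It suffices that \<open>T\<close> captures one side of the neighbourhood of
  \<open>b\<close> in \<open>R\<close>: this makes \<open>b\<close> itself satisfy the dipolar
  condition once \<open>T\<close> is added.\<close>

lemma dipolar_around:
  assumes far: "\<And>a z. a \<in> R \<Longrightarrow> z \<in> Z \<Longrightarrow> z \<notin> nb r a"
    and b: "starts3 r Z b \<or> starts3 (r\<inverse>) Z b \<or> starts2 r Z b \<and> starts2 (r\<inverse>) Z b"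
  shows "\<exists>T. dipolar r T R \<and> dicol r 3 T \<and> (r `` {b} \<inter> R \<subseteq> T \<or> r\<inverse> `` {b} \<inter> R \<subseteq> T)"
proof -
  interpret conv: trifree_P6 "r\<inverse>"
    by (rule converse_trifree_P6)
  have col: "dicol r 3 (s `` {b} \<inter> R)" if "s = r \<or> s = r\<inverse>" for s
  proof -
    have "s `` {b} \<inter> R \<subseteq> R \<inter> nb r b"
      using that unfolding nb_def by blast
    with dicol_nb have "dicol r 1 (s `` {b} \<inter> R)"
      by (rule dicol_subset)
    then show ?thesis
      by (rule dicol_mono) simp
  qed
  from b consider "starts3 r Z b" | "starts3 (r\<inverse>) Z b" | "starts2 r Z b" "starts2 (r\<inverse>) Z b"
    by blast
  then show ?thesis
  proof cases
    case 1
    then have "dipolar r (r\<inverse> `` {b} \<inter> R) R"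
      using far by (rule dipolar_in_neighbours[rotated])
    with col show ?thesis
      by blast
  next
    case 2
    \<comment> \<open>Reversing all arcs exchanges the in- and out-neighbours of
      \<open>b\<close>.\<close>
    have "dipolar (r\<inverse>) ((r\<inverse>)\<inverse> `` {b} \<inter> R) R"
      by (rule conv.dipolar_in_neighbours[OF _ 2]) (simp add: nb_converse far)
    then have "dipolar r (r `` {b} \<inter> R) R"
      by (simp add: dipolar_converse)
    with col show ?thesis
      by blast
  next
    case 3
    have "r `` {b} \<inter> R \<subseteq> R \<inter> nb r b"
      unfolding nb_def by blast
    then show ?thesis
      using dipolar_two_steps[OF far 3] by blast
  qed
qed

section \<open>Attachment of a vertex to a seven-vertex walk\<close>

text \<open>If \<open>b\<close> sends an arc to the \<open>i\<close>-th vertex, then i \<le> 4, and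
  without \<open>starts3\<close> it is adjacent to the vertex two further on. An arc from there into
  \<open>b\<close> gives both forms of \<open>starts2\<close>; an arc from \<open>b\<close> repeats
  the argument, which stops because \<open>b\<close> sends none to \<open>z5\<close> or
  \<open>z6\<close>. Arcs into \<open>b\<close> are treated dually, going down.\<close>

lemma starts_walk:
  assumes walk: "(z0, z1) \<in> r" "(z1, z2) \<in> r" "(z2, z3) \<in> r" "(z3, z4) \<in> r" "(z4, z5) \<in> r" "(z5, z6) \<in> r"
    and Z: "Z = {z0, z1, z2, z3, z4, z5, z6}"
    and b: "(z0, b) \<notin> r" "(z1, b) \<notin> r" "(b, z5) \<notin> r" "(b, z6) \<notin> r"
    and z: "z \<in> Z" "z \<in> nb r b"
  shows "starts3 r Z b \<or> starts3 (r\<inverse>) Z b \<or> starts2 r Z b \<and> starts2 (r\<inverse>) Z b"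
proof -
  have S3: "starts3 r Z b \<or> (b, z) \<in> r \<or> (z, b) \<in> r"
    if "(b, x) \<in> r" "(x, y) \<in> r" "(y, z) \<in> r" "x \<in> Z" "y \<in> Z" "z \<in> Z" for x y z
    using that starts3I[of b x r y z Z] unfolding nb_def by blast
  have E3: "starts3 (r\<inverse>) Z b \<or> (b, z) \<in> r \<or> (z, b) \<in> r"
    if "(x, b) \<in> r" "(y, x) \<in> r" "(z, y) \<in> r" "x \<in> Z" "y \<in> Z" "z \<in> Z" for x y z
    using that starts3I[of b x "r\<inverse>" y z Z] unfolding nb_converse nb_def by blast
  have S2: "starts2 r Z b" if "(b, x) \<in> r" "(x, y) \<in> r" "x \<in> Z" "y \<in> Z" for x y
    using that by (rule starts2I)
  have E2: "starts2 (r\<inverse>) Z b" if "(x, b) \<in> r" "(y, x) \<in> r" "x \<in> Z" "y \<in> Z" for x y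
    using that starts2I[of b x "r\<inverse>" y Z] by blast
  have ZI: "z0 \<in> Z" "z1 \<in> Z" "z2 \<in> Z" "z3 \<in> Z" "z4 \<in> Z" "z5 \<in> Z" "z6 \<in> Z"
    using Z by auto
  \<comment> \<open>Instantiating the four rules at every position of the walk leaves a
    propositional problem about the arcs between \<open>b\<close> and the walk.\<close>
  note s = S2[OF _ walk(1)] S2[OF _ walk(2)] S2[OF _ walk(3)] S2[OF _ walk(4)] S2[OF _ walk(5)] S2[OF _ walk(6)]
  note e = E2[OF _ walk(1)] E2[OF _ walk(2)] E2[OF _ walk(3)] E2[OF _ walk(4)] E2[OF _ walk(5)] E2[OF _ walk(6)]
  note s3 = S3[OF _ walk(1,2)] S3[OF _ walk(2,3)] S3[OF _ walk(3,4)] S3[OF _ walk(4,5)] S3[OF _ walk(5,6)]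
  note e3 = E3[OF _ walk(2,1)] E3[OF _ walk(3,2)] E3[OF _ walk(4,3)] E3[OF _ walk(5,4)] E3[OF _ walk(6,5)]
  have "z0 \<in> nb r b \<or> z1 \<in> nb r b \<or> z2 \<in> nb r b \<or> z3 \<in> nb r b \<or> z4 \<in> nb r b \<or> z5 \<in> nb r b \<or> z6 \<in> nb r b"
    using z Z by blast
  then show ?thesis
    using s e s3 e3 ZI b unfolding nb_def Image_singleton_iff Un_iff converse_iff by argo
qed

lemma dipolar_if_head_tail:
  assumes fin: "finite W" and ne: "W \<noteq> {}" and head: "head_set r W" and tail: "head_set (r\<inverse>) W"
  shows "\<exists>S. S \<noteq> {} \<and> dipolar r S W \<and> dicol r 13 S"
proof -
  from ne obtain z3 where z3: "z3 \<in> W"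
    by blast
  with head obtain z0 z1 z2 where h: "(z0, z1) \<in> r" "(z1, z2) \<in> r" "(z2, z3) \<in> r"
    "\<forall>b\<in>W. (z0, b) \<notin> r \<and> (z1, b) \<notin> r"
    unfolding head_set_def by blast
  from z3 tail obtain z6 z5 z4 where t: "(z5, z6) \<in> r" "(z4, z5) \<in> r" "(z3, z4) \<in> r"
    "\<forall>b\<in>W. (b, z6) \<notin> r \<and> (b, z5) \<notin> r"
    unfolding head_set_def converse_iff by blast
  define Z where "Z = {z0, z1, z2, z3, z4, z5, z6}"
  define B where "B = (\<Union>z\<in>Z. W \<inter> nb r z)"
  define R where "R = W - B"
  have far: "z \<notin> nb r a" if "a \<in> R" "z \<in> Z" for a z
    using that nb_sym[of a r z] unfolding R_def B_def by blast
  have "\<exists>T. dipolar r T R \<and> dicol r 3 T \<and> (r `` {b} \<inter> R \<subseteq> T \<or> r\<inverse> `` {b} \<inter> R \<subseteq> T)" if b: "b \<in> B" for b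
  proof (rule dipolar_around[OF far])
    obtain z where "z \<in> Z" "z \<in> nb r b" "b \<in> W"
      using b nb_sym[of _ r b] unfolding B_def by blast
    with h t show "starts3 r Z b \<or> starts3 (r\<inverse>) Z b \<or> starts2 r Z b \<and> starts2 (r\<inverse>) Z b"
      by (intro starts_walk[OF h(1-3) t(3,2,1) Z_def]) auto
  qed
  then have "\<exists>T. \<forall>b\<in>B. dipolar r (T b) R \<and> dicol r 3 (T b) \<and>
      (r `` {b} \<inter> R \<subseteq> T b \<or> r\<inverse> `` {b} \<inter> R \<subseteq> T b)"
    by (intro bchoice ballI)
  then obtain T where T: "\<forall>b\<in>B. dipolar r (T b) R \<and> dicol r 3 (T b) \<and>
      (r `` {b} \<inter> R \<subseteq> T b \<or> r\<inverse> `` {b} \<inter> R \<subseteq> T b)"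
    by (rule exE)
  have BW: "B \<subseteq> W"
    unfolding B_def by blast
  \<comment> \<open>Six colours suffice for all the sets \<open>T b\<close> together, however many
    vertices \<open>B\<close> has.\<close>
  have "dicol r (2 * 3) (\<Union>b\<in>B. T b)"
  proof (rule dicol_UN_dipolar)
    show "finite B"
      using BW fin by (rule finite_subset)
  qed (use T in auto)
  \<comment> \<open>\<open>B\<close> is covered by the neighbourhoods of at most seven vertices,
    each stable.\<close>
  moreover have "dicol r 7 B"
  proof -
    have "card Z \<le> 7"
      unfolding Z_def using card_length[of "[z0, z1, z2, z3, z4, z5, z6]"] by simp
    moreover have "dicol r (card Z * 1) B"
      unfolding B_def by (rule dicol_UN) (auto simp: Z_def dicol_nb[simplified])
    ultimately show ?thesis
      by (auto intro: dicol_mono)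
  qed
  ultimately have "dicol r (7 + 2 * 3) (B \<union> (\<Union>b\<in>B. T b))"
    by (intro dicol_Un)
  then have "dicol r 13 (B \<union> (\<Union>b\<in>B. T b))"
    by simp
  moreover have "dipolar r (B \<union> (\<Union>b\<in>B. T b)) W"
    unfolding dipolar_def
  proof (intro conjI ballI)
    show "B \<union> (\<Union>b\<in>B. T b) \<subseteq> W"
      using T BW unfolding dipolar_def R_def by blast
    fix s
    assume "s \<in> B \<union> (\<Union>b\<in>B. T b)"
    then consider "s \<in> B" | b where "b \<in> B" "s \<in> T b"
      by blast
    then show "(\<forall>u\<in>W - (B \<union> (\<Union>b\<in>B. T b)). (s, u) \<notin> r) \<or>
        (\<forall>u\<in>W - (B \<union> (\<Union>b\<in>B. T b)). (u, s) \<notin> r)"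
    \<comment> \<open>What is left of \<open>W\<close> lies in \<open>R\<close> outside every
      \<open>T b\<close>. A vertex of \<open>B\<close> has one side of its neighbourhood in
      \<open>R\<close> inside its own \<open>T\<close>; a vertex of \<open>T b\<close> inherits
      dipolarity in \<open>R\<close>.\<close>
    proof cases
      case 1
      then have "r `` {s} \<inter> R \<subseteq> T s \<or> r\<inverse> `` {s} \<inter> R \<subseteq> T s"
        using T by blast
      with 1 show ?thesis
        unfolding R_def by blast
    next
      case 2
      then have "dipolar r (T b) R"
        using T by blast
      then have "(\<forall>u\<in>R - T b. (s, u) \<notin> r) \<or> (\<forall>u\<in>R - T b. (u, s) \<notin> r)"
        using 2 unfolding dipolar_def by blast
      with 2 show ?thesis
        unfolding R_def by blast
    qed
  qed
  \<comment> \<open>The arc from \<open>z3\<close> to \<open>z4\<close> puts \<open>z3\<close> in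
    \<open>B\<close>, so the dipolar set is nonempty.\<close>
  moreover have "z3 \<in> B"
    using z3 t(3) unfolding B_def Z_def by (auto intro: nbI)
  ultimately show ?thesis
    by blast
qed

section \<open>The numerical bound for the arc relation\<close>

lemma dicol_110:
  assumes "finite V"
  shows "dicol r 110 V"
proof -
  interpret conv: trifree_P6 "r\<inverse>"
    by (rule converse_trifree_P6)
  have both: "dicol r 26 W" if W: "W \<subseteq> V" "head_set r W" "head_set (r\<inverse>) W" for W
  proof -
    have "dicol r (2 * 13) W"
    proof (rule dicol_if_dipolar_subsets)
      show "finite W"
        using W(1) assms by (rule finite_subset)
      show "\<exists>S. S \<noteq> {} \<and> dipolar r S U \<and> dicol r 13 S" if "U \<subseteq> W" "U \<noteq> {}" for U
        using that W \<open>finite W\<close> by (intro dipolar_if_head_tail) (auto intro: head_set_subset finite_subset)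
    qed
    then show ?thesis
      by simp
  qed
  \<comment> \<open>Searching against the arcs inside a head set \<open>W\<close> leads to subsets
    that satisfy both conditions, because \<open>head_set\<close> passes to subsets.\<close>
  have "dicol r 54 W" if W: "W \<subseteq> V" "head_set r W" for W
  proof -
    have "dicol (r\<inverse>) (2 * (26 + 1)) W"
    proof (rule conv.dicol_if_head_sets)
      show "finite W"
        using W(1) assms by (rule finite_subset)
      show "dicol (r\<inverse>) 26 U" if "U \<subseteq> W" "head_set (r\<inverse>) U" for U
        using that W both[of U] head_set_subset[of r W U] by (simp add: dicol_converse)
    qed
    then show ?thesis
      by (simp add: dicol_converse)
  qed
  then have "dicol r (2 * (54 + 1)) V"
    by (intro dicol_if_head_sets assms)
  then show ?thesis
    by simp
qed

end

section \<open>Digraphs\<close>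

context oriented_graph
begin

lemma triangle_free:
  assumes "clique_number G \<le> 2" "(u, v) \<in> arcs_ends G" "u \<in> nb (arcs_ends G) w"
  shows "v \<notin> nb (arcs_ends G) w"
proof
  assume v: "v \<in> nb (arcs_ends G) w"
  let ?K = "{u, v, w}"
  have ne: "u \<noteq> v" "u \<noteq> w" "v \<noteq> w"
    using assms(2,3) v adj_not_same unfolding nb_def by auto
  have "underlying_clique G ?K"
    using assms(2,3) v adj_in_verts
    unfolding underlying_clique_def nb_def by (auto simp: parcs_mk_symmetric arcs_ends_conv)
  then have "card ?K \<in> card ` {K. underlying_clique G K}"
    by blast
  then have "card ?K \<le> clique_number G"
    unfolding clique_number_def using finite_underlying_cliques by (intro Max_ge) auto
  with assms(1) ne show False
    by simp
qed

lemma contains_induced_directed_path: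
  fixes v :: "nat \<Rightarrow> 'a"
  assumes v: "\<And>i. i \<in> {1..n} \<Longrightarrow> v i \<in> verts G" and inj: "inj_on v {1..n}"
    and arcs: "\<And>i j. i \<in> {1..n} \<Longrightarrow> j \<in> {1..n} \<Longrightarrow> (v i, v j) \<in> arcs_ends G \<longleftrightarrow> j = i + 1"
  shows "contains_induced G (directed_path n)"
proof -
  define H where "H = G \<restriction> (v ` {1..n})"
  define g where "g = the_inv_into {1..n} v"
  have g: "g (v i) = i" if "i \<in> {1..n}" for i
    unfolding g_def using inj that by (rule the_inv_into_f_f)
  \<comment> \<open>An arc goes to the pair of indices of its ends, since the arcs of
    \<open>directed_path\<close> are pairs with projections as tail and head. It is injective
    because there are no parallel arcs.\<close>
  define h where "h = \<lparr> iso_verts = g, iso_arcs = (\<lambda>e. (g (tail G e), g (head G e))),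
    iso_head = snd, iso_tail = fst \<rparr>"
  have sub: "v ` {1..n} \<subseteq> verts G"
    using v by blast
  have vertsH: "verts H = v ` {1..n}"
    and arcsH: "arcs H = {e \<in> arcs G. tail G e \<in> v ` {1..n} \<and> head G e \<in> v ` {1..n}}"
    and endsH: "tail H = tail G" "head H = head G"
    unfolding H_def by auto
  have ind: "induced_subgraph H G"
    unfolding H_def using sub by (rule induced_induce)
  have arcH: "\<exists>i. 1 \<le> i \<and> i < n \<and> tail G e = v i \<and> head G e = v (i + 1)" if e: "e \<in> arcs H" for e
  proof -
    obtain i j where ij: "i \<in> {1..n}" "j \<in> {1..n}" "tail G e = v i" "head G e = v j" "e \<in> arcs G"
      using e unfolding arcsH by blast
    then have "(v i, v j) \<in> arcs_ends G"
      unfolding arcs_ends_conv by force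
    with arcs[OF ij(1,2)] have "j = i + 1"
      by simp
    with ij show ?thesis
      by auto
  qed
  have "pre_digraph.digraph_isomorphism H h"
    unfolding pre_digraph.digraph_isomorphism_def
  proof (intro conjI ballI)
    show "wf_digraph H"
      unfolding H_def by (rule wellformed_induce_subgraph)
    show "inj_on (iso_verts h) (verts H)"
      unfolding vertsH h_def by (auto intro!: inj_onI simp: g)
    show "inj_on (iso_arcs h) (arcs H)"
    proof (rule inj_onI)
      fix e e'
      assume e: "e \<in> arcs H" "e' \<in> arcs H" and eq: "iso_arcs h e = iso_arcs h e'"
      from arcH[OF e(1)] obtain i where
        i: "1 \<le> i" "i < n" "tail G e = v i" "head G e = v (i + 1)"
        by blast
      from arcH[OF e(2)] obtain j where
        j: "1 \<le> j" "j < n" "tail G e' = v j" "head G e' = v (j + 1)"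
        by blast
      have "i = j"
        using eq i j by (simp add: h_def g)
      with i j e show "e = e'"
        by (intro no_multi_arcs) (auto simp: arc_to_ends_def arcsH)
    qed
  qed (simp_all add: h_def endsH)
  moreover have "directed_path n = app_iso h H"
  proof -
    have "g ` v ` {1..n} = {1..n}"
      by (force simp: image_image g)
    moreover have "(\<lambda>e. (g (tail G e), g (head G e))) ` arcs H = {(i, i + 1) |i. 1 \<le> i \<and> i < n}"
    proof (intro equalityI subsetI)
      fix p
      assume "p \<in> (\<lambda>e. (g (tail G e), g (head G e))) ` arcs H"
      then obtain e where "e \<in> arcs H" "p = (g (tail G e), g (head G e))"
        by blast
      with arcH[OF this(1)] show "p \<in> {(i, i + 1) |i. 1 \<le> i \<and> i < n}"
        by (auto simp: g)
    next
      fix p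
      assume "p \<in> {(i, i + 1) |i. 1 \<le> i \<and> i < n}"
      then obtain i where i: "p = (i, i + 1)" "1 \<le> i" "i < n"
        by blast
      then have "(v i, v (i + 1)) \<in> arcs_ends G"
        using arcs[of i "i + 1"] by simp
      \<comment> \<open>Here \<open>reachableE\<close> turns membership in
        \<open>arcs_ends G\<close> into an actual arc.\<close>
      then obtain e where "e \<in> arcs G" "tail G e = v i" "head G e = v (i + 1)"
        by (rule reachableE)
      with i show "p \<in> (\<lambda>e. (g (tail G e), g (head G e))) ` arcs H"
        unfolding arcsH by (intro image_eqI[of _ _ e]) (auto simp: g)
    qed
    ultimately show ?thesis
      by (simp add: directed_path_def with_proj_def app_iso_def vertsH h_def)
  qed
  ultimately show ?thesis
    using ind unfolding contains_induced_def digraph_iso_def by blast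
qed

lemma trifree_P6_arcs_ends:
  assumes "clique_number G \<le> 2" "\<not> contains_induced G (directed_path 6)"
  shows "trifree_P6 (arcs_ends G)"
proof
  show "(v, u) \<notin> arcs_ends G" if "(u, v) \<in> arcs_ends G" for u v
    using that by (rule no_antiparallel)
  show "v \<notin> nb (arcs_ends G) w" if "(u, v) \<in> arcs_ends G" "u \<in> nb (arcs_ends G) w" for u v w
    using assms(1) that by (rule triangle_free)
  fix a b c d e f
  assume path: "(a, b) \<in> arcs_ends G" "(b, c) \<in> arcs_ends G" "(c, d) \<in> arcs_ends G"
      "(d, e) \<in> arcs_ends G" "(e, f) \<in> arcs_ends G"
    and chords: "c \<notin> nb (arcs_ends G) a" "d \<notin> nb (arcs_ends G) a" "e \<notin> nb (arcs_ends G) a"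
      "f \<notin> nb (arcs_ends G) a" "d \<notin> nb (arcs_ends G) b" "e \<notin> nb (arcs_ends G) b"
      "f \<notin> nb (arcs_ends G) b" "e \<notin> nb (arcs_ends G) c" "f \<notin> nb (arcs_ends G) c"
      "f \<notin> nb (arcs_ends G) d"
  define v where "v i = [a, b, c, d, e, f] ! (i - 1)" for i
  have v: "v 1 = a" "v 2 = b" "v 3 = c" "v 4 = d" "v 5 = e" "v 6 = f"
    by (simp_all add: v_def)
  have I: "{1..6::nat} = {1, 2, 3, 4, 5, 6}"
    by auto
  have no_loop: "(x, x) \<notin> arcs_ends G" for x
    using no_antiparallel by blast
  note no_rev = path[THEN no_antiparallel]
  note far = chords[unfolded nb_def Un_iff converse_iff Image_singleton_iff de_Morgan_disj]
  \<comment> \<open>All 36 index pairs are checked; \<open>v(1)[simplified]\<close> covers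
    \<open>v (Suc 0)\<close>, the form into which the simplifier brings \<open>v 1\<close>.\<close>
  have arcs: "(v i, v j) \<in> arcs_ends G \<longleftrightarrow> j = i + 1" if "i \<in> {1..6}" "j \<in> {1..6}" for i j
    using that unfolding I by (elim insertE emptyE; hypsubst) (simp_all add: v v(1)[simplified] no_loop path no_rev far)
  have "inj_on v {1..6}"
  proof (rule inj_onI)
    fix i j
    assume ij: "i \<in> {1..6::nat}" "j \<in> {1..6::nat}" and eq: "v i = v j"
    \<comment> \<open>Equal vertices have the same out- and in-neighbours on the path, which
      determine the index. Index 6 has no successor, so its predecessor 5 is compared
      instead.\<close>
    have *: "k = i + 1 \<longleftrightarrow> k = j + 1" "i = k + 1 \<longleftrightarrow> j = k + 1" if "k \<in> {1..6}" for k
      using arcs[of i k] arcs[of j k] arcs[of k i] arcs[of k j] ij eq that by auto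
    show "i = j"
    proof (cases "i = 6")
      case True
      then show ?thesis
        using *(2)[of 5] by simp
    next
      case False
      then show ?thesis
        using *(1)[of "i + 1"] ij by simp
    qed
  qed
  moreover have "v i \<in> verts G" if "i \<in> {1..6}" for i
    using that unfolding I
    by (elim insertE emptyE; hypsubst)
      (use path in \<open>auto simp: v v(1)[simplified] intro: adj_in_verts\<close>)
  ultimately have "contains_induced G (directed_path 6)"
    using arcs by (intro contains_induced_directed_path)
  with assms(2) show False ..
qed

section \<open>Back to the dichromatic number\<close>

text \<open>A directed cycle is a nonempty closed walk, so its start would reach itself along the
  restricted arc relation.\<close>

lemma acyclic_digraph_induce_subgraph:
  assumes "acyclic_on (arcs_ends G) X"
  shows "acyclic_digraph (G \<restriction> X)"
proof -
  interpret X: wf_digraph "G \<restriction> X"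
    by (rule wellformed_induce_subgraph)
  have "arcs_ends (G \<restriction> X) \<subseteq> Restr (arcs_ends G) X"
    by (auto simp: arcs_ends_conv)
  then have acyclic: "acyclic (arcs_ends (G \<restriction> X))"
    using assms acyclic_subset unfolding acyclic_on_def by blast
  have False if p: "X.cycle p" for p
  proof -
    obtain u where "X.awalk u p u" "p \<noteq> []"
      using p unfolding X.cycle_def by blast
    then have "u \<rightarrow>\<^sup>+\<^bsub>G \<restriction> X\<^esub> u"
      by (rule X.reachable1_awalkI)
    with acyclic show False
      unfolding acyclic_def by blast
  qed
  then show ?thesis
    unfolding acyclic_digraph_def by blast
qed

lemma dichromatic_number_le:
  assumes "dicol (arcs_ends G) k (verts G)"
  shows "dichromatic_number G \<le> k"
proof -
  obtain f where f: "\<forall>v\<in>verts G. f v < k" "\<And>c. acyclic_on (arcs_ends G) {v \<in> verts G. f v = c}"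
    using assms unfolding dicol_def by blast
  \<comment> \<open>Only attained colours index the blocks, since blocks of a partition are
    nonempty; there may be fewer than \<open>k\<close>.\<close>
  define P where "P = (\<lambda>c. {v \<in> verts G. f v = c}) ` f ` verts G"
  have "partition_on (verts G) P"
    unfolding P_def partition_on_def disjoint_def by auto
  moreover have "finite P"
    unfolding P_def by simp
  moreover have "\<forall>X\<in>P. acyclic_digraph (G \<restriction> X)"
    unfolding P_def using f(2) acyclic_digraph_induce_subgraph by blast
  ultimately have "dicolorable G (card P)"
    unfolding dicolorable_def by blast
  then have "dichromatic_number G \<le> card P"
    unfolding dichromatic_number_def by (rule Least_le)
  also have "card P \<le> card (f ` verts G)"
    unfolding P_def by (intro card_image_le) simp
  also have "\<dots> \<le> card {..<k}"
    using f(1) by (intro card_mono) auto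
  finally show ?thesis
    by simp
qed

end

theorem theorem1p3:
  fixes D :: "('a, 'b) pre_digraph"
  assumes "oriented_graph D"
    and "clique_number D \<le> 2"
    and "\<not> contains_induced D (directed_path 6)"
  shows "dichromatic_number D \<le> 382"
proof -
  interpret oriented_graph D
    by (rule assms(1))
  interpret trifree_P6 "arcs_ends D"
    using assms(2,3) by (rule trifree_P6_arcs_ends)
  \<comment> \<open>The argument gives 110, which is below the bound claimed.\<close>
  have "dichromatic_number D \<le> 110"
    by (intro dichromatic_number_le dicol_110) simp
  then show ?thesis
    by simp
qed

end
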